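(* For all $x,y\in\mathbb{H}^n$, we have $$u_{\mathbb{H}^n}(x,y)\le \rho_{\mathbb{H}^n}(x,y)+2\log 2,$$ and the inequality is sharp.
   Context: $\mathbb{H}^n=\{x=(x_1,\dots,x_n)\in\mathbb{R}^n:x_n>0\}$, and $|\cdot|$ is the Euclidean norm. For a domain $D\subsetneq\mathbb{R}^n$ and $x\in D$, $d(x)$ denotes the Euclidean distance from $x$ to the boundary of $D$, and the Gromov hyperbolic metric $u_D$ is $$u_D(x,y)=2\log\frac{|x-y|+\max\{d(x),d(y)\}}{\sqrt{d(x)\,d(y)}},\qquad x,y\in D.$$ For $D=\mathbb{H}^n$ one has $d(x)=x_n$. The hyperbolic metric $\rho_{\mathbb{H}^n}$ is defined by $$\cosh\rho_{\mathbb{H}^n}(x,y)=1+\frac{|x-y|^2}{2x_ny_n},\qquad x,y\in\mathbb{H}^n.$$ "Sharp" means that the additive constant $2\log 2$ cannot be replaced by a smaller constant. *)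

theory Defs
  imports "HOL-Analysis.Analysis"
begin

text \<open>
  The index type \<open>'n\<close> is an arbitrary nonempty finite linear order, so that \<open>real ^ 'n\<close> is
  \<open>n\<close>-dimensional Euclidean space with ordered coordinates, and the last coordinate
  \<open>x\<^sub>n\<close> is the one at the greatest index.
\<close>

definition last_coord :: "real ^ 'n::{finite,linorder} \<Rightarrow> real" where
  "last_coord x = x $ Max UNIV"

definition upper_half_space :: "(real ^ 'n::{finite,linorder}) set" where
  "upper_half_space = {x. last_coord x > 0}"

text \<open>
  Intended for \<open>x \<in> D\<close> with \<open>D\<close> a nonempty open proper subset of the space; then the frontier is nonempty,
  and the convention \<open>infdist x {} = 0\<close> plays no role.
\<close>

definition boundary_dist :: "(real ^ 'n::finite) set \<Rightarrow> real ^ 'n \<Rightarrow> real" where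
  "boundary_dist D x = infdist x (frontier D)"

definition gromov_hyperbolic_metric ::
    "(real ^ 'n::finite) set \<Rightarrow> real ^ 'n \<Rightarrow> real ^ 'n \<Rightarrow> real" where
  "gromov_hyperbolic_metric D x y =
     2 * ln ((norm (x - y) + max (boundary_dist D x) (boundary_dist D y)) /
             sqrt (boundary_dist D x * boundary_dist D y))"

definition half_space_hyperbolic_metric ::
    "real ^ 'n::{finite,linorder} \<Rightarrow> real ^ 'n::{finite,linorder} \<Rightarrow> real" where
  "half_space_hyperbolic_metric x y =
     arcosh (1 + (norm (x - y))\<^sup>2 / (2 * last_coord x * last_coord y))"

text \<open>
  The metric is the unique nonnegative solution of its usual defining equation.
\<close>

lemma half_space_hyperbolic_metric_unique:
  fixes x y :: "real ^ 'n::{finite,linorder}"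
  assumes "x \<in> upper_half_space" and "y \<in> upper_half_space"
  shows "r = half_space_hyperbolic_metric x y \<longleftrightarrow>
           r \<ge> 0 \<and> cosh r = 1 + (norm (x - y))\<^sup>2 / (2 * last_coord x * last_coord y)"
proof -
  define t where "t = 1 + (norm (x - y))\<^sup>2 / (2 * last_coord x * last_coord y)"
  have t: "t \<ge> 1"
    using assms by (simp add: t_def upper_half_space_def)
  have "r = arcosh t \<longleftrightarrow> r \<ge> 0 \<and> cosh r = t"
    using t arcosh_cosh_real[of r] cosh_arcosh_real[of t] arcosh_nonneg_real[of t] by auto
  thus ?thesis
    by (simp add: half_space_hyperbolic_metric_def t_def)
qed

end

theory Submission
  imports Defs
begin

text \<open>
  Write \<open>a\<close>, \<open>b\<close> for the heights of two points of the half-space and \<open>d\<close> for their Euclidean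
  distance. The half-angle formula turns the definition of the hyperbolic distance \<open>\<rho>\<close> into
  \<open>sinh (\<rho>/2) = d / (2 * sqrt (a * b))\<close>, so that
  \<open>2 * exp (\<rho>/2) = (d + sqrt (d\<^sup>2 + 4 * a * b)) / sqrt (a * b)\<close>. After exponentiating and cancelling
  \<open>sqrt (a * b)\<close>, the claimed inequality reads \<open>max a b \<le> sqrt (d\<^sup>2 + 4 * a * b)\<close>. It holds because
  the distance of two points is at least the difference of their heights, which gives
  \<open>d\<^sup>2 + 4 * a * b \<ge> (a + b)\<^sup>2\<close>.

  The constant is approached on a vertical line. At heights \<open>1\<close> and \<open>t > 1\<close> the hyperbolic distance
  is \<open>ln t\<close>, the Gromov hyperbolic distance is \<open>2 * ln ((2 * t - 1) / sqrt t)\<close>, and their difference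
  \<open>2 * ln (2 - 1 / t)\<close> tends to \<open>2 * ln 2\<close> as \<open>t\<close> grows. This needs only the last coordinate, so it
  covers dimension one as well.
\<close>

lemma norm_axis: "norm (axis i (a :: real) :: real ^ 'n::finite) = \<bar>a\<bar>"
proof -
  have "(axis i a :: real ^ 'n) = a *\<^sub>R axis i 1"
    by (simp add: vec_eq_iff axis_def)
  then show ?thesis
    by simp
qed

lemma frontier_upper_half_space:
  "frontier (upper_half_space :: (real ^ 'n::{finite,linorder}) set) = {x. last_coord x = 0}"
proof -
  have coord: "last_coord x = axis (Max UNIV) 1 \<bullet> x" for x :: "real ^ 'n::{finite,linorder}"
    by (simp add: last_coord_def inner_axis')
  show ?thesis
    unfolding upper_half_space_def coord
    by (rule frontier_halfspace_gt) (simp add: axis_eq_0_iff)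
qed

lemma abs_last_coord_diff_le_norm: "\<bar>last_coord x - last_coord y\<bar> \<le> norm (x - y)"
  using component_le_norm_cart[of "x - y" "Max UNIV"] by (simp add: last_coord_def)

lemma boundary_dist_upper_half_space:
  fixes x :: "real ^ 'n::{finite,linorder}"
  assumes "x \<in> upper_half_space"
  shows "boundary_dist upper_half_space x = last_coord x"
proof -
  have pos: "last_coord x > 0"
    using assms by (simp add: upper_half_space_def)
  define p where "p = x - axis (Max UNIV) (last_coord x)"
  have p: "last_coord p = 0"
    by (simp add: p_def last_coord_def)
  have dist_p: "dist x p = last_coord x"
    using pos by (simp add: p_def dist_norm norm_axis)
  show ?thesis
    unfolding boundary_dist_def frontier_upper_half_space
  proof (rule antisym)
    show "infdist x {x. last_coord x = 0} \<le> last_coord x"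
      using infdist_le[of p "{x. last_coord x = 0}" x] p dist_p by simp
    show "last_coord x \<le> infdist x {x. last_coord x = 0}"
    proof -
      have "last_coord x \<le> dist x y" if "last_coord y = 0" for y
        using abs_last_coord_diff_le_norm[of x y] that by (simp add: dist_norm)
      then show ?thesis
        using p by (auto simp: infdist_def intro!: cINF_greatest)
    qed
  qed
qed

text \<open>
  Both \<open>\<rho>\<close> and twice this \<open>arsinh\<close> are nonnegative, and the half-angle formula
  \<open>cosh (2 * s) = 1 + 2 * (sinh s)\<^sup>2\<close> shows that they have the same \<open>cosh\<close>. In this form
  \<open>exp (\<rho>/2)\<close> is an explicit algebraic expression.
\<close>

lemma half_space_hyperbolic_metric_arsinh:
  assumes "x \<in> upper_half_space" and "y \<in> upper_half_space"
  shows "half_space_hyperbolic_metric x y =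
           2 * arsinh (norm (x - y) / (2 * sqrt (last_coord x * last_coord y)))"
proof -
  define s where "s = norm (x - y) / (2 * sqrt (last_coord x * last_coord y))"
  have pos: "last_coord x > 0" "last_coord y > 0"
    using assms by (auto simp: upper_half_space_def)
  have "s \<ge> 0"
    using pos by (simp add: s_def)
  then have "arsinh s \<ge> 0"
    by (simp add: arsinh_real_def add_increasing)
  moreover have "cosh (2 * arsinh s) = 1 + 2 * s\<^sup>2"
    by (simp add: cosh_double cosh_square_eq)
  moreover have "2 * s\<^sup>2 = (norm (x - y))\<^sup>2 / (2 * last_coord x * last_coord y)"
    using pos by (simp add: s_def power_divide power_mult_distrib)
  ultimately show ?thesis
    using half_space_hyperbolic_metric_unique[OF assms, of "2 * arsinh s"] by (simp add: s_def)
qed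

lemma gromov_hyperbolic_metric_upper_half_space_le:
  assumes "x \<in> upper_half_space" and "y \<in> upper_half_space"
  shows "gromov_hyperbolic_metric upper_half_space x y
           \<le> half_space_hyperbolic_metric x y + 2 * ln 2"
proof -
  define a b d where "a = last_coord x" and "b = last_coord y" and "d = norm (x - y)"
  define q s where "q = sqrt (a * b)" and "s = d / (2 * q)"
  have pos: "a > 0" "b > 0"
    using assms by (auto simp: a_def b_def upper_half_space_def)
  have q: "q > 0" "q\<^sup>2 = a * b"
    using pos by (simp_all add: q_def)
  have d: "d \<ge> 0" "\<bar>a - b\<bar> \<le> d"
    using abs_last_coord_diff_le_norm by (auto simp: a_def b_def d_def)
  have "max a b \<le> a + b"
    using pos by simp
  also have "a + b \<le> sqrt (d\<^sup>2 + 4 * (a * b))"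
  proof (rule real_le_rsqrt)
    have "(a - b)\<^sup>2 \<le> d\<^sup>2"
      using d by (simp add: abs_le_square_iff[symmetric])
    then show "(a + b)\<^sup>2 \<le> d\<^sup>2 + 4 * (a * b)"
      by (simp add: power2_eq_square algebra_simps)
  qed
  also have "d\<^sup>2 + 4 * (a * b) = (2 * q)\<^sup>2 * (s\<^sup>2 + 1)"
    using q pos by (simp add: s_def power_divide power_mult_distrib field_simps)
  also have "sqrt \<dots> = 2 * q * sqrt (s\<^sup>2 + 1)"
    using q(1) by (simp add: real_sqrt_mult)
  finally have "(d + max a b) / q \<le> 2 * (s + sqrt (s\<^sup>2 + 1))"
    using q by (simp add: s_def field_simps)
  moreover have "(d + max a b) / q > 0"
    using pos d q by (simp add: add_nonneg_pos less_max_iff_disj)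
  ultimately have "ln ((d + max a b) / q) \<le> ln (2 * (s + sqrt (s\<^sup>2 + 1)))"
    by simp
  also have "\<dots> = ln 2 + arsinh s"
    using arsinh_real_aux[of s] by (simp add: arsinh_real_def ln_mult del: distrib_left_numeral)
  finally show ?thesis
    using assms
    by (simp add: gromov_hyperbolic_metric_def boundary_dist_upper_half_space
        half_space_hyperbolic_metric_arsinh a_def b_def d_def q_def s_def)
qed

lemma vertical_pair_distances:
  fixes x y :: "real ^ 'n::{finite,linorder}"
  assumes "t \<ge> 1" and "x = axis (Max UNIV) 1" and "y = axis (Max UNIV) t"
  shows "x \<in> upper_half_space" and "y \<in> upper_half_space"
    and "half_space_hyperbolic_metric x y = ln t"
    and "gromov_hyperbolic_metric upper_half_space x y = ln t + 2 * ln (2 - 1 / t)"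
proof -
  have coords: "last_coord x = 1" "last_coord y = t"
    by (simp_all add: last_coord_def assms)
  show x: "x \<in> upper_half_space" and y: "y \<in> upper_half_space"
    using assms(1) by (simp_all add: upper_half_space_def coords)
  have "x - y = axis (Max UNIV) (1 - t)"
    by (simp add: assms vec_eq_iff axis_def)
  then have norm: "norm (x - y) = t - 1"
    using assms(1) by (simp add: norm_axis)
  have "cosh (ln t) = 1 + (norm (x - y))\<^sup>2 / (2 * last_coord x * last_coord y)"
    using assms(1) by (simp add: cosh_ln_real norm coords field_simps power2_eq_square)
  then show "half_space_hyperbolic_metric x y = ln t"
    using half_space_hyperbolic_metric_unique[OF x y, of "ln t"] assms(1) by simp
  have "(t - 1 + max 1 t) / sqrt t = sqrt t * (2 - 1 / t)"
    using assms(1) by (simp add: max_def field_simps)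
  moreover have "1 / t < 2"
    using assms(1) by (simp add: field_simps)
  ultimately have "2 * ln ((t - 1 + max 1 t) / sqrt t) = ln t + 2 * ln (2 - 1 / t)"
    using assms(1) by (simp add: ln_mult ln_sqrt)
  then show "gromov_hyperbolic_metric upper_half_space x y = ln t + 2 * ln (2 - 1 / t)"
    by (simp add: gromov_hyperbolic_metric_def boundary_dist_upper_half_space x y coords norm)
qed

lemma gromov_hyperbolic_metric_upper_half_space_sharp:
  fixes c :: real
  assumes "c < 2 * ln 2"
  shows "\<exists>x \<in> upper_half_space :: (real ^ 'n::{finite,linorder}) set. \<exists>y \<in> upper_half_space.
           half_space_hyperbolic_metric x y + c < gromov_hyperbolic_metric upper_half_space x y"
proof -
  define \<delta> where "\<delta> = 2 - exp (c / 2)"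
  have "exp (c / 2) < exp (ln 2)"
    using assms by (subst exp_less_cancel_iff) simp
  then have \<delta>: "\<delta> > 0"
    by (simp add: \<delta>_def)
  \<comment> \<open>Any height above \<open>1 / \<delta>\<close> makes \<open>2 - 1 / t\<close> exceed \<open>exp (c / 2)\<close>; adding \<open>1\<close> also
      ensures \<open>t \<ge> 1\<close>.\<close>
  define t where "t = 1 + 1 / \<delta>"
  have t: "t \<ge> 1" "1 / t < \<delta>"
    using \<delta> by (simp_all add: t_def field_simps)
  then have "exp (c / 2) < 2 - 1 / t"
    by (simp add: \<delta>_def)
  then have "c / 2 < ln (2 - 1 / t)"
    using exp_gt_zero[of "c / 2"] by (smt (verit) ln_less_cancel_iff ln_exp)
  then show ?thesis
    using vertical_pair_distances[OF t(1) refl refl, where 'n = 'n]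
    by (intro bexI[of _ "axis (Max UNIV) 1"] bexI[of _ "axis (Max UNIV) t"]) auto
qed

theorem theorem3p6:
  shows "(\<forall>x \<in> upper_half_space :: (real ^ 'n::{finite,linorder}) set. \<forall>y \<in> upper_half_space.
            gromov_hyperbolic_metric upper_half_space x y
              \<le> half_space_hyperbolic_metric x y + 2 * ln 2)
       \<and> (\<forall>c < 2 * ln 2. \<not> (\<forall>x \<in> upper_half_space :: (real ^ 'n::{finite,linorder}) set. \<forall>y \<in> upper_half_space.
            gromov_hyperbolic_metric upper_half_space x y
              \<le> half_space_hyperbolic_metric x y + c))"
  using gromov_hyperbolic_metric_upper_half_space_le
    gromov_hyperbolic_metric_upper_half_space_sharp[where 'n = 'n]
  by (meson linorder_not_less)

end
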